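(* Let $M:P\to\mathsf{Vec}$ be a constructible persistence module over a poset $P$ with a free cover $\varphi:F\Rightarrow M$. Then $\partial m_\varphi$ is a persistence diagram of $M$; that is, $\partial m_\varphi$ and $\partial\,\mathsf{null}_M$ agree on off-diagonal intervals: $\partial m_\varphi(a,b)=\partial\,\mathsf{null}_M(a,b)$ for all $a<b$ in $P$.
   Context: Fix a field $\mathbb{K}$; $\mathsf{Vec}$ is the category of finite-dimensional $\mathbb{K}$-vector spaces. A persistence module is a functor $M:P\to\mathsf{Vec}$ from a poset $P$. A co-closure operator on $P$ is an order-preserving map $c:P\to P$ with $c(p)\le p$ for all $p$ and $c\circ c=c$. $M$ is constructible if there is a co-closure operator $c$ with finite image such that $M\circ c\cong M$. $\bar P=\{(a,b)\in P\times P:a\le b\}$ with the product order. For a function $m:X\to\mathbb{Z}$ on a poset, its Möbius inversion is the (unique, if it exists) $\partial m:X\to\mathbb{Z}$ with $m(y)=\sum_{x\le y}\partial m(x)$ for all $y$, each sum having finitely many nonzero terms. The nullity function of $M$ is $\mathsf{null}_M:\bar P\to\mathbb{Z}$, $\mathsf{null}_M(a,b)=\dim\ker M(a\le b)$; $\partial\,\mathsf{null}_M$ exists when $M$ is constructible. Here Möbius inversions are taken on $\bar P$. A persistence diagram is a finitely supported function $\bar P\to\mathbb{Z}$; a persistence diagram of $M$ is any persistence diagram $w:\bar P\to\mathbb{Z}$ with $w(a,b)=\partial\,\mathsf{null}_M(a,b)$ for all $a<b$. For $a\in P$, $\mathbb{K}^{\uparrow a}:P\to\mathsf{Vec}$ is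 given by $\mathbb{K}^{\uparrow a}(b)=\mathbb{K}$ if $a\le b$ and $0$ otherwise, with $\mathbb{K}^{\uparrow a}(b\le c)=\mathrm{id}$ for $a\le b\le c$. A persistence module is free if it is isomorphic to a finite direct sum of modules $\mathbb{K}^{\uparrow a}$. A free cover of $M$ is a free module $F:P\to\mathsf{Vec}$ with a surjective natural transformation $\varphi:F\Rightarrow M$. The birth-death function induced by $\varphi$ is $m_\varphi:\bar P\to\mathbb{Z}$, $m_\varphi(a,b)=\dim\big(F(a)\cap\ker\varphi_b\big)$, where the intersection is the pullback of $F(a)\xrightarrow{F(a\le b)}F(b)\hookleftarrow\ker\varphi_b$ (the map $F(a\le b)$ is injective). *)

theory Defs
  imports "HOL-Library.Function_Algebras" "HOL-Analysis.Product_Vector"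
begin

section \<open>Persistence modules\<close>

text \<open>
  A functor from the poset \<open>'p\<close> to finite-dimensional \<open>'k\<close>-vector spaces. The spaces are
  finite-dimensional subspaces of one vector space on the type \<open>'v\<close>, with scalar multiplication
  \<open>scl\<close>. Up to natural isomorphism this loses nothing: take the direct sum of all the spaces of a
  given functor as the ambient space, which may be infinite-dimensional. The maps \<open>mor a b\<close> matter
  only for \<open>a \<le> b\<close> and on \<open>obj a\<close>.
\<close>

record ('p, 'k, 'v) pmod =
  scl :: "'k \<Rightarrow> 'v \<Rightarrow> 'v"
  obj :: "'p \<Rightarrow> 'v set"
  mor :: "'p \<Rightarrow> 'p \<Rightarrow> 'v \<Rightarrow> 'v"

definition fin_dim_subspace :: "('k::field \<Rightarrow> 'v::ab_group_add \<Rightarrow> 'v) \<Rightarrow> 'v set \<Rightarrow> bool" where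
  "fin_dim_subspace s V \<longleftrightarrow> module.subspace s V \<and> (\<exists>B. finite B \<and> V = module.span s B)"

definition linear_map_between ::
  "('k::field \<Rightarrow> 'v::ab_group_add \<Rightarrow> 'v) \<Rightarrow> 'v set \<Rightarrow>
   ('k \<Rightarrow> 'w::ab_group_add \<Rightarrow> 'w) \<Rightarrow> 'w set \<Rightarrow> ('v \<Rightarrow> 'w) \<Rightarrow> bool" where
  "linear_map_between s V t W f \<longleftrightarrow>
     (\<forall>x\<in>V. f x \<in> W) \<and>
     (\<forall>x\<in>V. \<forall>y\<in>V. f (x + y) = f x + f y) \<and>
     (\<forall>r. \<forall>x\<in>V. f (s r x) = t r (f x))"

definition persistence_module :: "('p::order, 'k::field, 'v::ab_group_add) pmod \<Rightarrow> bool" where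
  "persistence_module M \<longleftrightarrow>
     vector_space (scl M) \<and>
     (\<forall>a. fin_dim_subspace (scl M) (obj M a)) \<and>
     (\<forall>a b. a \<le> b \<longrightarrow> linear_map_between (scl M) (obj M a) (scl M) (obj M b) (mor M a b)) \<and>
     (\<forall>a. \<forall>x\<in>obj M a. mor M a a x = x) \<and>
     (\<forall>a b c. a \<le> b \<longrightarrow> b \<le> c \<longrightarrow> (\<forall>x\<in>obj M a. mor M a c x = mor M b c (mor M a b x)))"

definition natural_transformation ::
  "('p::order, 'k::field, 'v::ab_group_add) pmod \<Rightarrow> ('p, 'k, 'w::ab_group_add) pmod \<Rightarrow>
   ('p \<Rightarrow> 'v \<Rightarrow> 'w) \<Rightarrow> bool" where
  "natural_transformation M N \<eta> \<longleftrightarrow>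
     (\<forall>a. linear_map_between (scl M) (obj M a) (scl N) (obj N a) (\<eta> a)) \<and>
     (\<forall>a b. a \<le> b \<longrightarrow> (\<forall>x\<in>obj M a. \<eta> b (mor M a b x) = mor N a b (\<eta> a x)))"

definition naturally_isomorphic ::
  "('p::order, 'k::field, 'v::ab_group_add) pmod \<Rightarrow> ('p, 'k, 'w::ab_group_add) pmod \<Rightarrow> bool" where
  "naturally_isomorphic M N \<longleftrightarrow>
     (\<exists>\<eta>. natural_transformation M N \<eta> \<and> (\<forall>a. bij_betw (\<eta> a) (obj M a) (obj N a)))"

definition pullback_along ::
  "('p, 'k, 'v) pmod \<Rightarrow> ('q \<Rightarrow> 'p) \<Rightarrow> ('q, 'k, 'v) pmod" where
  "pullback_along M c =
     \<lparr>scl = scl M, obj = (\<lambda>a. obj M (c a)), mor = (\<lambda>a b. mor M (c a) (c b))\<rparr>"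

definition co_closure :: "('p::order \<Rightarrow> 'p) \<Rightarrow> bool" where
  "co_closure c \<longleftrightarrow> mono c \<and> (\<forall>p. c p \<le> p) \<and> c \<circ> c = c"

definition constructible :: "('p::order, 'k::field, 'v::ab_group_add) pmod \<Rightarrow> bool" where
  "constructible M \<longleftrightarrow>
     (\<exists>c. co_closure c \<and> finite (range c) \<and> naturally_isomorphic (pullback_along M c) M)"


section \<open>Free modules and free covers\<close>

definition up_module :: "'p::order \<Rightarrow> ('p, 'k::field, 'k) pmod" where
  "up_module a =
     \<lparr>scl = (*),
      obj = (\<lambda>b. if a \<le> b then UNIV else {0}),
      mor = (\<lambda>b c x. if a \<le> b then x else 0)\<rparr>"

text \<open>
  The direct sum over a finite index set \<open>I\<close>: families indexed by the type \<open>'i\<close> that vanish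
  outside \<open>I\<close>, with pointwise operations.
\<close>

definition direct_sum ::
  "'i set \<Rightarrow> ('i \<Rightarrow> ('p, 'k::field, 'v::ab_group_add) pmod) \<Rightarrow> ('p, 'k, 'i \<Rightarrow> 'v) pmod" where
  "direct_sum I N =
     \<lparr>scl = (\<lambda>r f i. scl (N i) r (f i)),
      obj = (\<lambda>a. {f. (\<forall>i\<in>I. f i \<in> obj (N i) a) \<and> (\<forall>i. i \<notin> I \<longrightarrow> f i = 0)}),
      mor = (\<lambda>a b f i. if i \<in> I then mor (N i) a b (f i) else 0)\<rparr>"

definition free_module :: "('p::order, 'k::field, 'v::ab_group_add) pmod \<Rightarrow> bool" where
  "free_module F \<longleftrightarrow>
     persistence_module F \<and>
     (\<exists>(n::nat) g. naturally_isomorphic F (direct_sum {..<n} (\<lambda>i. up_module (g i))))"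

definition free_cover ::
  "('p::order, 'k::field, 'v::ab_group_add) pmod \<Rightarrow> ('p, 'k, 'w::ab_group_add) pmod \<Rightarrow>
   ('p \<Rightarrow> 'w \<Rightarrow> 'v) \<Rightarrow> bool" where
  "free_cover M F \<phi> \<longleftrightarrow>
     free_module F \<and> natural_transformation F M \<phi> \<and> (\<forall>a. \<phi> a ` obj F a = obj M a)"


section \<open>Intervals\<close>

typedef (overloaded) ('p::order) intvl = "{(a, b). (a::'p) \<le> b}"
  by auto

setup_lifting type_definition_intvl

lift_definition birth :: "'p::order intvl \<Rightarrow> 'p" is fst .
lift_definition death :: "'p::order intvl \<Rightarrow> 'p" is snd .

lemma birth_le_death: "birth I \<le> death I"
  by transfer auto

lemma ex_intvl: "a \<le> b \<Longrightarrow> \<exists>I. birth I = a \<and> death I = b"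
  by transfer auto

instantiation intvl :: (order) order
begin

definition less_eq_intvl :: "'a intvl \<Rightarrow> 'a intvl \<Rightarrow> bool" where
  "I \<le> J \<longleftrightarrow> birth I \<le> birth J \<and> death I \<le> death J"

definition less_intvl :: "'a intvl \<Rightarrow> 'a intvl \<Rightarrow> bool" where
  "I < J \<longleftrightarrow> I \<le> J \<and> \<not> J \<le> (I::'a intvl)"

instance
proof
  fix I J :: "'a intvl"
  assume "I \<le> J" "J \<le> I"
  then have "birth I = birth J" "death I = death J"
    by (auto simp: less_eq_intvl_def)
  then show "I = J"
    by transfer auto
qed (auto simp: less_eq_intvl_def less_intvl_def)

end


section \<open>Moebius inversion\<close>

definition is_moebius :: "('x::order \<Rightarrow> int) \<Rightarrow> ('x \<Rightarrow> int) \<Rightarrow> bool" where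
  "is_moebius m d \<longleftrightarrow>
     (\<forall>y. finite {x. x \<le> y \<and> d x \<noteq> 0} \<and> m y = (\<Sum>x | x \<le> y \<and> d x \<noteq> 0. d x))"

definition has_moebius :: "('x::order \<Rightarrow> int) \<Rightarrow> bool" where
  "has_moebius m \<longleftrightarrow> (\<exists>d. is_moebius m d)"

definition moebius :: "('x::order \<Rightarrow> int) \<Rightarrow> 'x \<Rightarrow> int"  ("\<partial>") where
  "\<partial> m = (THE d. is_moebius m d)"

lemma is_moebius_unique:
  assumes d: "is_moebius m d" and e: "is_moebius m e"
  shows "d = e"
proof (rule ccontr)
  assume "d \<noteq> e"
  then obtain y where y: "d y \<noteq> e y" by auto
  define A where "A = {x. x \<le> y \<and> d x \<noteq> e x}"
  have "A \<subseteq> {x. x \<le> y \<and> d x \<noteq> 0} \<union> {x. x \<le> y \<and> e x \<noteq> 0}"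
    by (auto simp: A_def)
  then have "finite A"
    using d e unfolding is_moebius_def by (meson finite_UnI finite_subset)
  moreover have "A \<noteq> {}" using y by (auto simp: A_def)
  ultimately obtain z where z: "z \<in> A" and zmin: "\<And>x. x \<in> A \<Longrightarrow> x \<le> z \<Longrightarrow> x = z"
    using finite_has_minimal[of A] by metis
  have below: "d x = e x" if "x \<le> z" "x \<noteq> z" for x
    using that z zmin[of x] by (auto simp: A_def dest: order_trans)
  define S where "S = insert z ({x. x \<le> z \<and> d x \<noteq> 0} \<union> {x. x \<le> z \<and> e x \<noteq> 0})"
  have S: "finite S" using d e by (auto simp: S_def is_moebius_def)
  have "m z = (\<Sum>x\<in>S. d x)"
    unfolding d[unfolded is_moebius_def, rule_format, of z, THEN conjunct2]
    by (rule sum.mono_neutral_left) (use S in \<open>auto simp: S_def\<close>)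
  moreover have "m z = (\<Sum>x\<in>S. e x)"
    unfolding e[unfolded is_moebius_def, rule_format, of z, THEN conjunct2]
    by (rule sum.mono_neutral_left) (use S in \<open>auto simp: S_def\<close>)
  moreover have "(\<Sum>x\<in>S - {z}. d x) = (\<Sum>x\<in>S - {z}. e x)"
    by (rule sum.cong) (auto simp: S_def intro!: below)
  moreover have "z \<in> S" by (simp add: S_def)
  ultimately have "d z = e z"
    using sum.remove[OF S, of z d] sum.remove[OF S, of z e] by simp
  with z show False by (simp add: A_def)
qed

lemma moebius_eqI: "is_moebius m d \<Longrightarrow> \<partial> m = d"
  unfolding moebius_def using is_moebius_unique by blast

lemma is_moebius_moebius: "has_moebius m \<Longrightarrow> is_moebius m (\<partial> m)"
  unfolding has_moebius_def using moebius_eqI by metis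


section \<open>Nullity, birth-death functions and persistence diagrams\<close>

definition nullity :: "('p::order, 'k::field, 'v::ab_group_add) pmod \<Rightarrow> 'p intvl \<Rightarrow> int" where
  "nullity M I =
     int (vector_space.dim (scl M) {x \<in> obj M (birth I). mor M (birth I) (death I) x = 0})"

text \<open>
  \<open>F(a) \<inter> ker \<phi>\<^sub>b\<close> is the pullback of \<open>F(a) \<rightarrow> F(b) \<hookleftarrow> ker \<phi>\<^sub>b\<close>, as a subspace of the product.
\<close>

definition birth_death ::
  "('p::order, 'k::field, 'w::ab_group_add) pmod \<Rightarrow> ('p \<Rightarrow> 'w \<Rightarrow> 'v::ab_group_add) \<Rightarrow>
   'p intvl \<Rightarrow> int" where
  "birth_death F \<phi> I =
     int (vector_space.dim (module_prod.scale (scl F) (scl F))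
       {(x, y). x \<in> obj F (birth I) \<and> y \<in> {z \<in> obj F (death I). \<phi> (death I) z = 0} \<and>
                mor F (birth I) (death I) x = y})"

definition persistence_diagram :: "('p::order intvl \<Rightarrow> int) \<Rightarrow> bool" where
  "persistence_diagram w \<longleftrightarrow> finite {I. w I \<noteq> 0}"

definition persistence_diagram_of ::
  "('p::order, 'k::field, 'v::ab_group_add) pmod \<Rightarrow> ('p intvl \<Rightarrow> int) \<Rightarrow> bool" where
  "persistence_diagram_of M w \<longleftrightarrow>
     persistence_diagram w \<and> has_moebius (nullity M) \<and>
     (\<forall>I. birth I < death I \<longrightarrow> w I = \<partial> (nullity M) I)"

end

theory Submission
  imports Defs
begin

text \<open>
  Let \<open>\<phi> : F \<Rightarrow> M\<close> be the free cover. By naturality \<open>F(a) \<inter> ker \<phi>\<^sub>b\<close> consists of those \<open>x\<close> in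
  \<open>F(a)\<close> with \<open>\<phi>\<^sub>a x\<close> in \<open>ker M(a \<le> b)\<close>, so it is the full preimage of \<open>ker M(a \<le> b)\<close> under the
  surjection \<open>\<phi>\<^sub>a\<close>. Rank-nullity therefore gives
  \<open>m\<^sub>\<phi>(a, b) = dim ker \<phi>\<^sub>a + null\<^sub>M(a, b)\<close>, where \<open>dim ker \<phi>\<^sub>a = dim F(a) - dim M(a)\<close>
  (\<open>birth_death_decomposition\<close>): the birth-death function differs from the nullity function only
  by a function \<open>k\<close> of the birth coordinate.

  The Moebius inversion of \<open>(a, b) \<mapsto> k(a)\<close> is that of \<open>k\<close>, placed on the diagonal: the diagonal
  points below \<open>(a, b)\<close> are exactly the \<open>(c, c)\<close> with \<open>c \<le> a\<close> (\<open>is_moebius_birth\<close>). By linearity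
  of Moebius inversion the two inversions agree off the diagonal.

  What remains is existence and finite support. For \<open>dim F\<close> the inversion counts the generators of
  \<open>F\<close> at each point. The functions \<open>dim M\<close> and \<open>null\<^sub>M\<close> are invariant under a co-closure
  operator with finite image, and such a function is inverted on that finite image
  (\<open>co_closure_invariant_moebius\<close>).
\<close>

section \<open>Moebius inversion on posets and intervals\<close>

lemma is_moebius_sum:
  assumes "is_moebius m d" and "finite A" and "{x. x \<le> y \<and> d x \<noteq> 0} \<subseteq> A"
    and "\<And>x. x \<in> A \<Longrightarrow> x \<le> y"
  shows "m y = (\<Sum>x\<in>A. d x)"
proof -
  have "m y = (\<Sum>x | x \<le> y \<and> d x \<noteq> 0. d x)"
    using assms(1) unfolding is_moebius_def by blast
  also have "\<dots> = (\<Sum>x\<in>A. d x)"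
    by (rule sum.mono_neutral_left) (use assms in auto)
  finally show ?thesis .
qed

lemma is_moebius_linear:
  assumes d: "is_moebius m d" and e: "is_moebius n e"
  shows "is_moebius (\<lambda>x. u * m x + v * n x) (\<lambda>x. u * d x + v * e x)"
  unfolding is_moebius_def
proof (intro allI)
  fix y
  let ?f = "\<lambda>x. u * d x + v * e x"
  let ?A = "{x. x \<le> y \<and> d x \<noteq> 0} \<union> {x. x \<le> y \<and> e x \<noteq> 0}"
  have A: "finite ?A"
    using d e by (simp add: is_moebius_def)
  have sub: "{x. x \<le> y \<and> ?f x \<noteq> 0} \<subseteq> ?A" by auto
  have "m y = (\<Sum>x\<in>?A. d x)" "n y = (\<Sum>x\<in>?A. e x)"
    by (rule is_moebius_sum[OF d A] is_moebius_sum[OF e A]; auto)+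
  then have "u * m y + v * n y = (\<Sum>x\<in>?A. ?f x)"
    by (simp only: sum.distrib sum_distrib_left)
  also have "\<dots> = (\<Sum>x | x \<le> y \<and> ?f x \<noteq> 0. ?f x)"
    by (rule sum.mono_neutral_right[OF A sub]) auto
  finally show "finite {x. x \<le> y \<and> ?f x \<noteq> 0} \<and>
      u * m y + v * n y = (\<Sum>x | x \<le> y \<and> ?f x \<noteq> 0. ?f x)"
    using finite_subset[OF sub A] by simp
qed

lemma finite_poset_moebius:
  fixes m :: "'x::order \<Rightarrow> int"
  assumes "finite A"
  shows "\<exists>d. (\<forall>x. x \<notin> A \<longrightarrow> d x = 0) \<and> (\<forall>y\<in>A. m y = (\<Sum>x | x \<in> A \<and> x \<le> y. d x))"
  using assms
proof (induction A rule: finite_psubset_induct)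
  case (psubset A)
  show ?case
  proof (cases "A = {}")
    case True
    then show ?thesis by auto
  next
    case False
    \<comment> \<open>Removing a maximal element \<open>z\<close> leaves all sums at other elements unchanged.\<close>
    then obtain z where z: "z \<in> A" and zmax: "\<And>x. x \<in> A \<Longrightarrow> z \<le> x \<Longrightarrow> x = z"
      using finite_has_maximal[OF psubset.hyps] by metis
    obtain d where d0: "\<And>x. x \<notin> A - {z} \<Longrightarrow> d x = 0"
      and d: "\<And>y. y \<in> A - {z} \<Longrightarrow> m y = (\<Sum>x | x \<in> A - {z} \<and> x \<le> y. d x)"
      using psubset.IH[of "A - {z}"] z by (metis Diff_subset insert_Diff_single insert_absorb
          psubsetI Diff_iff singletonI)
    let ?e = "d(z := m z - (\<Sum>x | x \<in> A - {z} \<and> x \<le> z. d x))"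
    have "m y = (\<Sum>x | x \<in> A \<and> x \<le> y. ?e x)" if y: "y \<in> A" for y
    proof (cases "y = z")
      case True
      have "{x. x \<in> A \<and> x \<le> z} = insert z {x. x \<in> A - {z} \<and> x \<le> z}"
        using z by auto
      moreover have "(\<Sum>x | x \<in> A - {z} \<and> x \<le> z. ?e x) = (\<Sum>x | x \<in> A - {z} \<and> x \<le> z. d x)"
        by (rule sum.cong) auto
      ultimately show ?thesis
        using True psubset.hyps by simp
    next
      case False
      then have "{x. x \<in> A \<and> x \<le> y} = {x. x \<in> A - {z} \<and> x \<le> y}"
        using zmax y by auto
      moreover have "(\<Sum>x | x \<in> A - {z} \<and> x \<le> y. ?e x) = (\<Sum>x | x \<in> A - {z} \<and> x \<le> y. d x)"
        by (rule sum.cong) auto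
      ultimately show ?thesis
        using d[of y] False y by simp
    qed
    moreover have "?e x = 0" if "x \<notin> A" for x
      using that z d0 by auto
    ultimately show ?thesis by blast
  qed
qed

text \<open>
  A point \<open>x\<close> of the image of \<open>c\<close> satisfies \<open>x \<le> y\<close> iff \<open>x \<le> c y\<close>. So an inversion on the finite
  poset \<open>range c\<close>, extended by zero, is one on the whole poset.
\<close>

lemma co_closure_invariant_moebius:
  assumes c: "co_closure c" and fin: "finite (range c)" and inv: "\<And>y. m (c y) = m y"
  obtains d where "is_moebius m d" and "finite {x. d x \<noteq> 0}"
proof -
  obtain d where d0: "\<And>x. x \<notin> range c \<Longrightarrow> d x = 0"
    and d: "\<And>y. y \<in> range c \<Longrightarrow> m y = (\<Sum>x | x \<in> range c \<and> x \<le> y. d x)"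
    using finite_poset_moebius[OF fin, of m] by blast
  have below: "x \<le> c y \<longleftrightarrow> x \<le> y" if "x \<in> range c" for x y
  proof -
    have "c x = x" using that c by (auto simp: co_closure_def fun_eq_iff)
    then show ?thesis
      using c unfolding co_closure_def by (metis monoD order_trans)
  qed
  have supp: "finite {x. d x \<noteq> 0}"
    by (rule finite_subset[OF _ fin]) (use d0 in auto)
  have "m y = (\<Sum>x | x \<le> y \<and> d x \<noteq> 0. d x)" for y
  proof -
    have "m y = (\<Sum>x | x \<in> range c \<and> x \<le> c y. d x)"
      using d[of "c y"] inv by simp
    also have "{x. x \<in> range c \<and> x \<le> c y} = {x. x \<in> range c \<and> x \<le> y}"
      using below by blast
    also have "(\<Sum>x | x \<in> range c \<and> x \<le> y. d x) = (\<Sum>x | x \<le> y \<and> d x \<noteq> 0. d x)"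
      by (rule sum.mono_neutral_right) (use d0 fin in auto)
    finally show ?thesis .
  qed
  then have "is_moebius m d"
    using supp by (simp add: is_moebius_def)
  with supp that show ?thesis by blast
qed

lemma intvl_eqI: "birth I = birth J \<Longrightarrow> death I = death J \<Longrightarrow> I = J"
  by transfer auto

text \<open>
  Since the birth of an interval \<open>J\<close> is at most its death, the diagonal points \<open>(c, c)\<close> below \<open>J\<close>
  correspond to the points \<open>c\<close> below \<open>birth J\<close>.
\<close>

lemma is_moebius_birth:
  assumes d: "is_moebius k d"
  shows "is_moebius (\<lambda>I. k (birth I)) (\<lambda>I. if birth I = death I then d (birth I) else 0)"
  unfolding is_moebius_def
proof
  fix J :: "'a intvl"
  let ?D = "\<lambda>I. if birth I = death I then d (birth I) else 0"
  let ?A = "{I. I \<le> J \<and> ?D I \<noteq> 0}"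
  let ?B = "{x. x \<le> birth J \<and> d x \<noteq> 0}"
  have bij: "bij_betw birth ?A ?B"
    unfolding bij_betw_def
  proof
    show "inj_on birth ?A"
      by (rule inj_onI) (auto intro!: intvl_eqI split: if_splits)
    show "birth ` ?A = ?B"
    proof
      show "birth ` ?A \<subseteq> ?B"
        by (auto simp: less_eq_intvl_def split: if_splits)
      show "?B \<subseteq> birth ` ?A"
      proof
        fix x assume x: "x \<in> ?B"
        obtain I where I: "birth I = x" "death I = x"
          using ex_intvl[of x x] by auto
        then have "I \<in> ?A"
          using x birth_le_death[of J] by (auto simp: less_eq_intvl_def)
        with I show "x \<in> birth ` ?A" by blast
      qed
    qed
  qed
  have B: "finite ?B" "k (birth J) = (\<Sum>x\<in>?B. d x)"
    using d unfolding is_moebius_def by blast+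
  have "(\<Sum>x\<in>?B. d x) = (\<Sum>I\<in>?A. d (birth I))"
    by (rule sum.reindex_bij_betw[OF bij, symmetric])
  also have "\<dots> = (\<Sum>I\<in>?A. ?D I)"
    by (rule sum.cong) (auto split: if_splits)
  finally show "finite ?A \<and> k (birth J) = (\<Sum>I\<in>?A. ?D I)"
    using bij_betw_finite[OF bij] B by simp
qed

lemma finite_diagonal_support:
  assumes "finite {x. d x \<noteq> 0}"
  shows "finite {I. (if birth I = death I then d (birth I) else 0) \<noteq> 0}"
proof (rule inj_on_finite[OF _ _ assms])
  let ?A = "{I. (if birth I = death I then d (birth I) else 0) \<noteq> 0}"
  show "inj_on birth ?A"
    by (rule inj_onI) (auto intro!: intvl_eqI split: if_splits)
  show "birth ` ?A \<subseteq> {x. d x \<noteq> 0}"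
    by (auto split: if_splits)
qed

lemma co_closure_intvl:
  assumes c: "co_closure c" and fin: "finite (range c)"
  obtains C where "co_closure C" and "finite (range C)"
    and "\<And>I. birth (C I) = c (birth I)" and "\<And>I. death (C I) = c (death I)"
proof -
  have mono: "mono c" and below: "\<And>p. c p \<le> p" and idem: "\<And>p. c (c p) = c p"
    using c by (auto simp: co_closure_def fun_eq_iff)
  have "\<forall>I. \<exists>J. birth J = c (birth I) \<and> death J = c (death I)"
    using ex_intvl monoD[OF mono birth_le_death] by blast
  then obtain C where C: "\<And>I. birth (C I) = c (birth I)" "\<And>I. death (C I) = c (death I)"
    by metis
  have "co_closure C"
    unfolding co_closure_def
  proof (intro conjI allI)
    show "mono C"
      by (rule monoI) (auto simp: less_eq_intvl_def C intro: monoD[OF mono])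
    show "C p \<le> p" for p by (simp add: less_eq_intvl_def C below)
    show "C \<circ> C = C"
      by (rule ext) (auto intro!: intvl_eqI simp: C idem)
  qed
  moreover have "finite (range C)"
  proof (rule inj_on_finite[of "\<lambda>I. (birth I, death I)" _ "range c \<times> range c"])
    show "inj_on (\<lambda>I. (birth I, death I)) (range C)"
      by (rule inj_onI) (auto intro: intvl_eqI)
  qed (use fin C in auto)
  ultimately show ?thesis using C that by blast
qed

section \<open>Linear maps between subspaces\<close>

lemma linear_map_between_subset:
  assumes "linear_map_between s V t W f" and "U \<subseteq> V"
  shows "linear_map_between s U t (f ` U) f"
  using assms unfolding linear_map_between_def by blast

lemma linear_map_between_zero:
  assumes "vector_space s" and "vector_space t" and "module.subspace s V"
    and "linear_map_between s V t W f"
  shows "f 0 = 0"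
proof -
  interpret s: vector_space s by fact
  interpret t: vector_space t by fact
  have "0 \<in> V" using s.subspace_0 assms(3) by blast
  then have "f (0 + 0) = f 0 + f 0"
    using assms(4) unfolding linear_map_between_def by blast
  then show ?thesis by simp
qed

lemma subspace_kernel_between:
  assumes s: "vector_space s" and t: "vector_space t" and V: "module.subspace s V"
    and f: "linear_map_between s V t W f"
  shows "module.subspace s {x \<in> V. f x = 0}"
proof -
  interpret s: vector_space s by fact
  interpret t: vector_space t by fact
  show ?thesis
    using linear_map_between_zero[OF assms] f V
    by (auto simp: linear_map_between_def s.subspace_def)
qed

lemma fin_dim_subspace_subset:
  assumes s: "vector_space s" and V: "fin_dim_subspace s V"
    and U: "module.subspace s U" and "U \<subseteq> V"
  shows "fin_dim_subspace s U"
proof -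
  interpret s: vector_space s by fact
  obtain B where B: "finite B" "V = s.span B"
    using V unfolding fin_dim_subspace_def by blast
  obtain C where C: "C \<subseteq> U" "s.independent C" "U \<subseteq> s.span C"
    by (metis s.basis_exists)
  have "finite C"
    using s.independent_span_bound[OF B(1) C(2)] C(1) B(2) assms(4) by blast
  moreover have "U = s.span C"
    using s.span_subspace[OF C(1,3) U] by simp
  ultimately show ?thesis
    using U unfolding fin_dim_subspace_def by blast
qed

text \<open>
  A map that is linear on a subspace only agrees there with a globally linear map, prescribed on
  a basis. This makes the theory of linear maps between whole vector spaces applicable.
\<close>

lemma linear_map_between_extend:
  assumes s: "vector_space s" and t: "vector_space t" and V: "module.subspace s V"
    and f: "linear_map_between s V t W f"
  obtains g where "Vector_Spaces.linear s t g" and "\<And>x. x \<in> V \<Longrightarrow> g x = f x"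
proof -
  interpret vector_space_pair s t
    using s t by (simp add: vector_space_pair_def)
  obtain B where B: "B \<subseteq> V" "vs1.independent B" "V \<subseteq> vs1.span B"
    by (metis vs1.basis_exists)
  obtain g where g: "Vector_Spaces.linear s t g" "\<And>x. x \<in> B \<Longrightarrow> g x = f x"
    using linear_independent_extend[OF B(2), of f] by blast
  interpret g: Vector_Spaces.linear s t g by fact
  have "x \<in> V \<and> g x = f x" if "x \<in> vs1.span B" for x
    using that
  proof (induction rule: vs1.span_induct_alt)
    case base
    then show ?case
      using linear_map_between_zero[OF s t V f] vs1.subspace_0[OF V] by simp
  next
    case (step c x y)
    have "x \<in> V" using step B(1) by blast
    then have cx: "s c x \<in> V" using vs1.subspace_scale[OF V] by blast
    then show ?case
      using step \<open>x \<in> V\<close> f g(2) vs1.subspace_add[OF V cx]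
      by (simp add: linear_map_between_def g.add g.scale)
  qed
  then show ?thesis using that g(1) B(3) by blast
qed

text \<open>
  Extend a basis \<open>A\<close> of the kernel to a basis \<open>B\<close> of \<open>V\<close>; then \<open>f\<close> maps \<open>B - A\<close> bijectively to
  a basis of the image.
\<close>

lemma rank_nullity:
  assumes s: "vector_space s" and t: "vector_space t" and V: "fin_dim_subspace s V"
    and f: "linear_map_between s V t W f"
  shows "vector_space.dim s {x \<in> V. f x = 0} + vector_space.dim t (f ` V) = vector_space.dim s V"
proof -
  interpret vector_space_pair s t
    using s t by (simp add: vector_space_pair_def)
  have V': "vs1.subspace V" using V by (simp add: fin_dim_subspace_def)
  obtain g where g: "Vector_Spaces.linear s t g" and gf: "\<And>x. x \<in> V \<Longrightarrow> g x = f x"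
    using linear_map_between_extend[OF s t V' f] by blast
  interpret g: Vector_Spaces.linear s t g by fact
  let ?K = "{x \<in> V. f x = 0}"
  have K: "vs1.subspace ?K" by (rule subspace_kernel_between[OF s t V' f])
  obtain A where A: "A \<subseteq> ?K" "vs1.independent A" "?K \<subseteq> vs1.span A" "card A = vs1.dim ?K"
    by (rule vs1.basis_exists[of ?K])
  obtain B where B: "A \<subseteq> B" "B \<subseteq> V" "vs1.independent B" "V \<subseteq> vs1.span B"
    by (rule vs1.maximal_independent_subset_extend[of A V]) (use A in auto)
  have spB: "vs1.span B = V" using vs1.span_subspace[OF B(2,4) V'] .
  have spA: "vs1.span A = ?K" using vs1.span_subspace[OF A(1,3) K] .
  obtain T where T: "finite T" "V = vs1.span T"
    using V unfolding fin_dim_subspace_def by blast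
  have finB: "finite B"
    using vs1.independent_span_bound[OF T(1) B(3)] B(2) T(2) by blast
  let ?C = "B - A"
  have indC: "vs1.independent ?C" using vs1.independent_mono[OF B(3)] by blast
  have spC: "vs1.span ?C \<subseteq> V" using spB vs1.span_mono[of ?C B] by blast
  \<comment> \<open>An element of the kernel in \<open>span ?C\<close> also lies in \<open>span A\<close>, so its coordinates in \<open>B\<close> vanish
      outside the disjoint sets \<open>?C\<close> and \<open>A\<close> alike.\<close>
  have inj: "inj_on g (vs1.span ?C)"
  proof -
    have "x = 0" if x: "x \<in> vs1.span ?C" and gx: "g x = 0" for x
    proof -
      have xA: "x \<in> vs1.span A" using x gx gf spC spA by auto
      have "vs1.representation B x = vs1.representation A x"
        "vs1.representation B x = vs1.representation ?C x"
        by (rule vs1.representation_extend[OF B(3)], use xA x B(1) in auto)+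
      then have "vs1.representation A x b = 0" for b
        using vs1.representation_ne_zero by (metis DiffD2)
      then show "x = 0"
        using vs1.sum_nonzero_representation_eq[OF A(2) xA] by simp
    qed
    then show ?thesis
      using g.inj_on_iff_eq_0[OF vs1.subspace_span] by blast
  qed
  have "vs2.dim (f ` V) = card (g ` ?C)"
  proof (rule vs2.dim_unique[OF _ _ _ refl])
    have fg: "f ` V = g ` V" using gf by auto
    show "g ` ?C \<subseteq> f ` V" using fg B(2) by blast
    show "vs2.independent (g ` ?C)"
      using g.independent_injective_image[OF indC inj] .
    have "g ` A \<subseteq> {0}" using A(1) gf by auto
    then have "g ` B \<subseteq> insert 0 (g ` ?C)" by auto
    then have "vs2.span (g ` B) \<subseteq> vs2.span (g ` ?C)"
      using vs2.span_mono vs2.span_insert_0 by metis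
    then show "f ` V \<subseteq> vs2.span (g ` ?C)"
      unfolding fg using g.span_image[of B] spB by simp
  qed
  also have "\<dots> = card ?C"
    using inj inj_on_subset vs1.span_superset card_image by metis
  finally have "vs2.dim (f ` V) = card ?C" .
  moreover have "vs1.dim V = card B"
    using vs1.basis_card_eq_dim[OF B(2,4,3)] by simp
  moreover have "card B = card A + card ?C"
    using finB B(1) by (metis card_Diff_subset card_mono finite_subset le_add_diff_inverse)
  ultimately show ?thesis using A(4) by simp
qed

lemma dim_linear_inj_image:
  assumes s: "vector_space s" and t: "vector_space t" and V: "fin_dim_subspace s V"
    and f: "linear_map_between s V t W f" and inj: "inj_on f V"
  shows "vector_space.dim t (f ` V) = vector_space.dim s V"
proof -
  interpret s: vector_space s by fact
  have V': "s.subspace V" using V by (simp add: fin_dim_subspace_def)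
  have "0 \<in> V" using V' by (rule s.subspace_0)
  then have "{x \<in> V. f x = 0} = {0}"
    using linear_map_between_zero[OF s t V' f] inj_onD[OF inj, of _ 0] by auto
  moreover have "s.dim {0} = 0"
    by (rule s.dim_unique[of "{}"]) (auto simp: s.independent_empty)
  ultimately show ?thesis using rank_nullity[OF s t V f] by simp
qed

section \<open>Dimensions of persistence modules\<close>

lemma persistence_moduleD:
  assumes "persistence_module M"
  shows "vector_space (scl M)"
    and "fin_dim_subspace (scl M) (obj M a)"
    and "module.subspace (scl M) (obj M a)"
    and "a \<le> b \<Longrightarrow> linear_map_between (scl M) (obj M a) (scl M) (obj M b) (mor M a b)"
  using assms by (auto simp: persistence_module_def fin_dim_subspace_def)

lemma dim_naturally_isomorphic:
  assumes "natural_transformation M N \<eta>" and "bij_betw (\<eta> a) (obj M a) (obj N a)"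
    and "vector_space (scl M)" and "fin_dim_subspace (scl M) (obj M a)"
    and "vector_space (scl N)"
  shows "vector_space.dim (scl N) (obj N a) = vector_space.dim (scl M) (obj M a)"
  using dim_linear_inj_image[OF assms(3,5,4), of "obj N a" "\<eta> a"] assms(1,2)
  by (auto simp: natural_transformation_def bij_betw_def)

lemma sum_fun_eval: "(\<Sum>i\<in>A. f i) x = (\<Sum>i\<in>A. f i x)"
  by (induction A rule: infinite_finite_induct) auto

lemma dim_sum_up_modules:
  fixes g :: "'i \<Rightarrow> 'p::order"
  assumes "finite I"
  defines "D \<equiv> direct_sum I (\<lambda>i. up_module (g i) :: ('p, 'k::field, 'k) pmod)"
  shows "vector_space (scl D)"
    and "vector_space.dim (scl D) (obj D a) = card {i \<in> I. g i \<le> a}"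
proof -
  have scl: "scl D = (\<lambda>r f i. r * f i)"
    by (simp add: D_def direct_sum_def up_module_def)
  show vs: "vector_space (scl D)"
    unfolding scl by unfold_locales (auto simp: fun_eq_iff algebra_simps)
  interpret vector_space "scl D" by fact
  let ?J = "{i \<in> I. g i \<le> a}"
  define e :: "'i \<Rightarrow> 'i \<Rightarrow> 'k" where "e i = (\<lambda>j. if j = i then 1 else 0)" for i
  have inj: "inj_on e ?J"
    by (rule inj_onI) (metis e_def zero_neq_one)
  have J: "finite ?J" using assms(1) by simp
  have obj: "obj D a = {f. \<forall>i. i \<notin> ?J \<longrightarrow> f i = 0}"
    by (auto simp: D_def direct_sum_def up_module_def split: if_splits)
  have sum_e: "(\<Sum>i\<in>?J. scl D (u i) (e i)) = (\<lambda>j. if j \<in> ?J then u j else 0)" for u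
  proof
    fix j
    have "(\<Sum>i\<in>?J. scl D (u i) (e i)) j = (\<Sum>i\<in>?J. if j = i then u i else 0)"
      unfolding scl sum_fun_eval by (rule sum.cong) (auto simp: e_def)
    then show "(\<Sum>i\<in>?J. scl D (u i) (e i)) j = (if j \<in> ?J then u j else 0)"
      using J by simp
  qed
  \<comment> \<open>The indicator functions \<open>e i\<close> of the generators born by \<open>a\<close> form a basis.\<close>
  show "dim (obj D a) = card ?J"
  proof (rule dim_unique)
    show "e ` ?J \<subseteq> obj D a" unfolding obj by (auto simp: e_def)
    show "obj D a \<subseteq> span (e ` ?J)"
    proof
      fix f assume "f \<in> obj D a"
      then have "f = (\<Sum>i\<in>?J. scl D (f i) (e i))"
        unfolding sum_e obj by (auto simp: fun_eq_iff)
      also have "\<dots> \<in> span (e ` ?J)"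
        by (intro span_sum span_scale span_base imageI)
      finally show "f \<in> span (e ` ?J)" .
    qed
    show "independent (e ` ?J)"
    proof (rule independent_if_scalars_zero)
      show "finite (e ` ?J)" using J by simp
      fix u x assume u: "(\<Sum>x\<in>e ` ?J. scl D (u x) x) = 0" and x: "x \<in> e ` ?J"
      obtain j where j: "j \<in> ?J" "x = e j" using x by blast
      have "(\<Sum>i\<in>?J. scl D (u (e i)) (e i)) = 0"
        using u sum.reindex[OF inj, of "\<lambda>x. scl D (u x) x"] by simp
      then have "(if j \<in> ?J then u (e j) else 0) = 0"
        using sum_e[of "\<lambda>i. u (e i)"] by (metis zero_fun_apply)
      then show "u x = 0" using j by simp
    qed
    show "card (e ` ?J) = card ?J" by (rule card_image[OF inj])
  qed
qed

text \<open>
  For \<open>F\<close> isomorphic to the direct sum of the modules \<open>up_module (g i)\<close>, the dimension at \<open>a\<close> is the number of \<open>i\<close> with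
  \<open>g i \<le> a\<close>. Grouping these \<open>i\<close> by the value of \<open>g i\<close> shows that the inversion counts the
  generators born at each point.
\<close>

lemma free_module_dim_moebius:
  fixes F :: "('p::order, 'k::field, 'w::ab_group_add) pmod"
  assumes F: "free_module F"
  obtains d where "is_moebius (\<lambda>a. int (vector_space.dim (scl F) (obj F a))) d"
    and "finite {x. d x \<noteq> 0}"
proof -
  have pm: "persistence_module F" using F by (simp add: free_module_def)
  obtain n :: nat and g :: "nat \<Rightarrow> 'p" where
    "naturally_isomorphic F (direct_sum {..<n} (\<lambda>i. up_module (g i)))"
    using F unfolding free_module_def by blast
  then obtain \<eta> where "natural_transformation F (direct_sum {..<n} (\<lambda>i. up_module (g i))) \<eta>"
    and "\<And>a. bij_betw (\<eta> a) (obj F a) (obj (direct_sum {..<n} (\<lambda>i. up_module (g i))) a)"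
    unfolding naturally_isomorphic_def by blast
  then have "vector_space.dim (scl (direct_sum {..<n} (\<lambda>i. up_module (g i) :: ('p, 'k, 'k) pmod)))
      (obj (direct_sum {..<n} (\<lambda>i. up_module (g i))) a) = vector_space.dim (scl F) (obj F a)" for a
    by (rule dim_naturally_isomorphic[OF _ _ persistence_moduleD(1,2)[OF pm]
          dim_sum_up_modules(1)[OF finite_lessThan]])
  then have dim: "vector_space.dim (scl F) (obj F a) = card {i \<in> {..<n}. g i \<le> a}" for a
    unfolding dim_sum_up_modules(2)[OF finite_lessThan] by (rule sym)
  let ?d = "\<lambda>x. int (card {i \<in> {..<n}. g i = x})"
  have supp: "{x. ?d x \<noteq> 0} \<subseteq> g ` {..<n}"
    by auto
  have "int (card {i \<in> {..<n}. g i \<le> a}) = (\<Sum>x | x \<le> a \<and> ?d x \<noteq> 0. ?d x)" for a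
  proof -
    let ?S = "{x. x \<le> a \<and> ?d x \<noteq> 0}"
    have "{i \<in> {..<n}. g i \<le> a} = (\<Union>x\<in>?S. {i \<in> {..<n}. g i = x})"
      by auto
    moreover have "card (\<Union>x\<in>?S. {i \<in> {..<n}. g i = x}) = (\<Sum>x\<in>?S. card {i \<in> {..<n}. g i = x})"
      by (rule card_UN_disjoint) (auto intro: finite_subset[of _ "g ` {..<n}"])
    ultimately show ?thesis by simp
  qed
  moreover have "finite {x. ?d x \<noteq> 0}"
    using finite_subset[OF supp] by blast
  ultimately show ?thesis
    using that[of ?d] unfolding is_moebius_def dim by auto
qed

text \<open>
  If \<open>M \<circ> c\<close> is isomorphic to \<open>M\<close>, then \<open>dim M\<close> is invariant under \<open>c\<close>, and \<open>null\<^sub>M\<close> is invariant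
  under applying \<open>c\<close> to both endpoints of an interval.
\<close>

lemma constructible_moebius:
  fixes M :: "('p::order, 'k::field, 'v::ab_group_add) pmod"
  assumes pm: "persistence_module M" and con: "constructible M"
  obtains d e where "is_moebius (\<lambda>a. int (vector_space.dim (scl M) (obj M a))) d"
    and "finite {x. d x \<noteq> 0}"
    and "is_moebius (nullity M) e" and "finite {I. e I \<noteq> 0}"
proof -
  note M = persistence_moduleD[OF pm]
  obtain c \<eta> where c: "co_closure c" and fin: "finite (range c)"
    and nat: "natural_transformation (pullback_along M c) M \<eta>"
    and bij: "\<And>a. bij_betw (\<eta> a) (obj (pullback_along M c) a) (obj M a)"
    using con unfolding constructible_def naturally_isomorphic_def by blast
  have lin: "linear_map_between (scl M) (obj M (c a)) (scl M) (obj M a) (\<eta> a)"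
    and comm: "a \<le> b \<Longrightarrow> x \<in> obj M (c a) \<Longrightarrow>
        \<eta> b (mor M (c a) (c b) x) = mor M a b (\<eta> a x)" for a b x
    using nat by (auto simp: natural_transformation_def pullback_along_def)
  have inj: "inj_on (\<eta> a) (obj M (c a))" and onto: "\<eta> a ` obj M (c a) = obj M a" for a
    using bij[of a] by (auto simp: bij_betw_def pullback_along_def)
  have "int (vector_space.dim (scl M) (obj M (c a))) = int (vector_space.dim (scl M) (obj M a))"
    for a
    using dim_linear_inj_image[OF M(1,1,2) lin inj] onto by simp
  then obtain d where d: "is_moebius (\<lambda>a. int (vector_space.dim (scl M) (obj M a))) d"
      "finite {x. d x \<noteq> 0}"
    by (rule co_closure_invariant_moebius[OF c fin])
  obtain C where C: "co_closure C" "finite (range C)"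
    and C': "\<And>I. birth (C I) = c (birth I)" "\<And>I. death (C I) = c (death I)"
    using co_closure_intvl[OF c fin] by blast
  \<comment> \<open>The isomorphism restricts to one between the kernels.\<close>
  have "nullity M (C I) = nullity M I" for I
  proof -
    let ?a = "birth I" and ?b = "death I"
    let ?K = "{x \<in> obj M (c ?a). mor M (c ?a) (c ?b) x = 0}"
    have ab: "?a \<le> ?b" by (rule birth_le_death)
    have cab: "c ?a \<le> c ?b" using c ab by (auto simp: co_closure_def dest: monoD)
    have K: "fin_dim_subspace (scl M) ?K"
      by (rule fin_dim_subspace_subset[OF M(1) M(2)])
        (auto intro: subspace_kernel_between[OF M(1,1,3) M(4)[OF cab]])
    have iff: "mor M ?a ?b (\<eta> ?a x) = 0 \<longleftrightarrow> mor M (c ?a) (c ?b) x = 0"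
      if x: "x \<in> obj M (c ?a)" for x
    proof -
      have y: "mor M (c ?a) (c ?b) x \<in> obj M (c ?b)"
        using M(4)[OF cab] x by (simp add: linear_map_between_def)
      have z: "\<eta> ?b 0 = 0" by (rule linear_map_between_zero[OF M(1,1,3) lin])
      have "0 \<in> obj M (c ?b)"
        using M(1,3) module.subspace_0 module_iff_vector_space by blast
      then show ?thesis
        using comm[OF ab x] z y inj by (metis inj_onD)
    qed
    have "\<eta> ?a ` ?K = {x \<in> obj M ?a. mor M ?a ?b x = 0}"
      using iff unfolding onto[of ?a, symmetric] by auto
    moreover have "vector_space.dim (scl M) (\<eta> ?a ` ?K) = vector_space.dim (scl M) ?K"
      by (rule dim_linear_inj_image[OF M(1,1) K linear_map_between_subset[OF lin]])
        (auto intro: inj_on_subset[OF inj])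
    ultimately show ?thesis by (simp add: nullity_def C')
  qed
  then obtain e where "is_moebius (nullity M) e" "finite {I. e I \<noteq> 0}"
    by (rule co_closure_invariant_moebius[OF C])
  with d that show ?thesis by blast
qed

section \<open>Birth-death functions of free covers\<close>

text \<open>
  Rank-nullity is used twice for \<open>\<phi>\<^sub>a\<close>: on the preimage \<open>U\<close> of \<open>ker M(a \<le> b)\<close>, which is isomorphic
  to the pullback, and on all of \<open>F(a)\<close>. Both restrictions have the kernel of \<open>\<phi>\<^sub>a\<close>, which thus
  cancels.
\<close>

lemma birth_death_decomposition:
  fixes M :: "('p::order, 'k::field, 'v::ab_group_add) pmod"
    and F :: "('p, 'k, 'w::ab_group_add) pmod"
  assumes pmM: "persistence_module M" and pmF: "persistence_module F"
    and nat: "natural_transformation F M \<phi>" and onto: "\<And>a. \<phi> a ` obj F a = obj M a"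
  shows "birth_death F \<phi> I =
    int (vector_space.dim (scl F) (obj F (birth I))) - int (vector_space.dim (scl M) (obj M (birth I)))
    + nullity M I"
proof -
  note M = persistence_moduleD[OF pmM] and F = persistence_moduleD[OF pmF]
  define a b where "a = birth I" and "b = death I"
  have ab: "a \<le> b" by (simp add: a_def b_def birth_le_death)
  have lin: "linear_map_between (scl F) (obj F a) (scl M) (obj M a) (\<phi> a)" for a
    using nat by (simp add: natural_transformation_def)
  have comm: "\<phi> b (mor F a b x) = mor M a b (\<phi> a x)" if "x \<in> obj F a" for x
    using nat ab that by (simp add: natural_transformation_def)
  interpret F: vector_space "scl F" by (rule F(1))
  interpret M: vector_space "scl M" by (rule M(1))
  interpret P: vector_space_prod "scl F" "scl F" ..
  have Pvs: "vector_space (module_prod.scale (scl F) (scl F))"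
    by (rule P.p.vector_space_axioms)
  define U where "U = {x \<in> obj F a. mor M a b (\<phi> a x) = 0}"
  have linMF: "linear_map_between (scl F) (obj F a) (scl M) (obj M b) (\<lambda>x. mor M a b (\<phi> a x))"
    using lin[of a] M(4)[OF ab] by (simp add: linear_map_between_def)
  have U: "fin_dim_subspace (scl F) U"
    by (rule fin_dim_subspace_subset[OF F(1) F(2)[of a]])
      (auto simp: U_def intro: subspace_kernel_between[OF F(1) M(1) F(3) linMF])
  \<comment> \<open>The pullback is the graph of \<open>F(a \<le> b)\<close> over \<open>U\<close>.\<close>
  let ?G = "\<lambda>x. (x, mor F a b x)"
  have linG: "linear_map_between (scl F) U (module_prod.scale (scl F) (scl F)) (?G ` U) ?G"
    using F(4)[OF ab] by (auto simp: linear_map_between_def U_def P.scale_prod)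
  have "{(x, y). x \<in> obj F a \<and> y \<in> {z \<in> obj F b. \<phi> b z = 0} \<and> mor F a b x = y} = ?G ` U"
    using comm F(4)[OF ab] by (auto simp: U_def linear_map_between_def)
  then have bd: "birth_death F \<phi> I = int (F.dim U)"
    using dim_linear_inj_image[OF F(1) Pvs U linG]
    by (simp add: birth_death_def a_def b_def inj_on_def)
  have "mor M a b 0 = 0" by (rule linear_map_between_zero[OF M(1,1,3) M(4)[OF ab]])
  then have ker: "{x \<in> U. \<phi> a x = 0} = {x \<in> obj F a. \<phi> a x = 0}"
    by (auto simp: U_def)
  have im: "\<phi> a ` U = {x \<in> obj M a. mor M a b x = 0}"
    using onto[of a] by (auto simp: U_def)
  have "F.dim {x \<in> obj F a. \<phi> a x = 0} + M.dim {x \<in> obj M a. mor M a b x = 0} = F.dim U"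
    using rank_nullity[OF F(1) M(1) U linear_map_between_subset[OF lin[of a]]] ker im
    by (simp add: U_def)
  moreover have "F.dim {x \<in> obj F a. \<phi> a x = 0} + M.dim (obj M a) = F.dim (obj F a)"
    using rank_nullity[OF F(1) M(1) F(2) lin[of a]] onto by simp
  ultimately show ?thesis
    unfolding bd by (simp add: nullity_def a_def b_def)
qed

theorem proposition7p10:
  fixes M :: "('p::order, 'k::field, 'v::ab_group_add) pmod"
    and F :: "('p, 'k, 'w::ab_group_add) pmod"
    and \<phi> :: "'p \<Rightarrow> 'w \<Rightarrow> 'v"
  assumes "persistence_module M"
    and "constructible M"
    and "free_cover M F \<phi>"
  shows "has_moebius (birth_death F \<phi>) \<and>
         persistence_diagram_of M (\<partial> (birth_death F \<phi>)) \<and>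
         (\<forall>I. birth I < death I \<longrightarrow> \<partial> (birth_death F \<phi>) I = \<partial> (nullity M) I)"
proof -
  have free: "free_module F" and nat: "natural_transformation F M \<phi>"
    and onto: "\<And>a. \<phi> a ` obj F a = obj M a"
    using assms(3) by (auto simp: free_cover_def)
  have pmF: "persistence_module F" using free by (simp add: free_module_def)
  let ?dF = "\<lambda>a. int (vector_space.dim (scl F) (obj F a))"
  let ?dM = "\<lambda>a. int (vector_space.dim (scl M) (obj M a))"
  obtain f where f: "is_moebius ?dF f" "finite {x. f x \<noteq> 0}"
    using free_module_dim_moebius[OF free] by blast
  obtain d e where d: "is_moebius ?dM d" "finite {x. d x \<noteq> 0}"
    and e: "is_moebius (nullity M) e" "finite {I. e I \<noteq> 0}"
    using constructible_moebius[OF assms(1,2)] by blast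
  let ?k = "\<lambda>x. f x - d x"
  let ?D = "\<lambda>I. if birth I = death I then ?k (birth I) else 0"
  have "is_moebius (\<lambda>x. ?dF x - ?dM x) ?k"
    using is_moebius_linear[OF f(1) d(1), of 1 "-1"] by simp
  then have "is_moebius (\<lambda>I. ?dF (birth I) - ?dM (birth I)) ?D"
    by (rule is_moebius_birth)
  from is_moebius_linear[OF this e(1), of 1 1]
  have "is_moebius (\<lambda>I. ?dF (birth I) - ?dM (birth I) + nullity M I) (\<lambda>I. ?D I + e I)"
    by simp
  moreover have "birth_death F \<phi> = (\<lambda>I. ?dF (birth I) - ?dM (birth I) + nullity M I)"
    using birth_death_decomposition[OF assms(1) pmF nat onto] by blast
  ultimately have bd: "is_moebius (birth_death F \<phi>) (\<lambda>I. ?D I + e I)"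
    by simp
  then have moebius_bd: "\<partial> (birth_death F \<phi>) = (\<lambda>I. ?D I + e I)"
    by (rule moebius_eqI)
  have "finite {x. ?k x \<noteq> 0}"
    by (rule finite_subset[of _ "{x. f x \<noteq> 0} \<union> {x. d x \<noteq> 0}"]) (use f d in auto)
  then have "finite {I. ?D I \<noteq> 0}" by (rule finite_diagonal_support)
  then have "finite {I. ?D I + e I \<noteq> 0}"
    using e(2) by (rule_tac finite_subset[of _ "{I. ?D I \<noteq> 0} \<union> {I. e I \<noteq> 0}"]) auto
  moreover have "?D I + e I = \<partial> (nullity M) I" if "birth I < death I" for I
    using less_imp_neq[OF that] moebius_eqI[OF e(1)] by simp
  ultimately show ?thesis
    using bd e(1) unfolding moebius_bd persistence_diagram_of_def persistence_diagram_def
      has_moebius_def by blast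
qed

end
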